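(* Let $\beta\in(0,1]$ and let $\sigma:[0,\infty)\times\mathbb{R}\to\mathbb{R}$ satisfy the following two conditions. (a) There are positive constants $C_1,C_2$ such that $C_1\le\sigma(t,x)\le C_2$ for all $(t,x)\in[0,\infty)\times\mathbb{R}$. (b) There exist a constant $C_\beta>0$ and, for every $T>0$, a constant $L_T>0$ such that $$|\sigma(s,x)-\sigma(t,y)|\le L_T|s-t|+C_\beta|x-y|^\beta\qquad\text{for all } s,t\in[0,T],\ x,y\in\mathbb{R}.$$ Let $\xi,\ \xi^{(n)},\ \tau,\ \tau_n$ be the processes defined in the context. Then for any $T>0$, $p\ge1$ and $\alpha\in[0,1/2)$ there exists a positive constant $\tilde K_T$, not depending on $n$, such that for all integers $n\ge1$ $$\left\{E\left[\sup_{0\le t\le T}\left|\xi^{(n)}_{\tau_n(t)}-\xi_{\tau(t)}\right|^p\right]\right\}^{1/p}\le \tilde K_T\,n^{-\alpha^2\beta}.$$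
   Context: Let $(\Omega,\mathcal{F},\mathbb{P},\{\mathcal{F}_t\}_{t\ge0})$ be a filtered probability space, $b=\{b_t\}_{t\ge0}$ a one-dimensional $\{\mathcal{F}_t\}$-Brownian motion (started at $0$) and $X_0$ an $\mathcal{F}_0$-measurable real random variable. Define $\xi_t=X_0+b_t$. Let $\varphi$ be the process of time change (a continuous, strictly increasing adapted process with $\varphi(0)=0$ and $\varphi(t)\to\infty$ as $t\to\infty$) that is the unique solution of $$\varphi(t)=\int_0^t\frac{ds}{\sigma^2(\varphi(s),\xi_s)},\qquad t\ge0,$$ and let $\tau=\varphi^{-1}$ be its pathwise inverse function. (The process $X_t=\xi_{\tau(t)}$ is then the weak solution of $dX_t=\sigma(t,X_t)\,dW_t$ with initial value $X_0$.) For an integer $n\ge1$ define: 1. the linear interpolation of $\xi$ on the grid of mesh $1/n$, $$\xi^{(n)}_t=\xi_{\lfloor nt\rfloor/n}+\Big(t-\frac{\lfloor nt\rfloor}{n}\Big)\big(\xi_{(\lfloor nt\rfloor+1)/n}-\xi_{\lfloor nt\rfloor/n}\big),\qquad t\ge0;$$ 2. the Euler approximation $\varphi_n$ of $\varphi$: $\varphi_n(0)=0$ and, for $k=0,1,2,\dots$, $$\varphi_n(t)=\varphi_n\Big(\frac kn\Big)+\Big(t-\frac kn\Big)\frac{1}{\sigma^2\big(\varphi_n(k/n),\xi_{k/n}\big)},\qquad t\in\Big(\frac kn,\frac{k+1}n\Big];$$ 3. the inverse function $\tau_n=\varphi_n^{-1}$, given explicitly by $$\tau_n(t)=\frac kn+\frac{t-\varphi_n(k/n)}{\varphi_n((k+1)/n)-\varphi_n(k/n)}\cdot\frac1n,\qquad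 t\in\Big[\varphi_n\Big(\frac kn\Big),\varphi_n\Big(\frac{k+1}n\Big)\Big).$$ *)

theory Defs
  imports "HOL-Probability.Probability"
begin

text \<open>
  Time is modelled by \<^typ>\<open>real\<close>; only nonnegative times carry information, so every condition
  below is restricted to them.
\<close>

definition filtered_prob_space :: "'a measure \<Rightarrow> (real \<Rightarrow> 'a measure) \<Rightarrow> bool" where
  "filtered_prob_space M F \<longleftrightarrow> prob_space M \<and>
     (\<forall>t\<ge>0. subalgebra M (F t)) \<and>
     (\<forall>s t. 0 \<le> s \<longrightarrow> s \<le> t \<longrightarrow> sets (F s) \<subseteq> sets (F t))"

definition adapted_process :: "(real \<Rightarrow> 'a measure) \<Rightarrow> (real \<Rightarrow> 'a \<Rightarrow> real) \<Rightarrow> bool" where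
  "adapted_process F X \<longleftrightarrow> (\<forall>t\<ge>0. X t \<in> borel_measurable (F t))"

text \<open>
  The second argument of \<^const>\<open>normal_density\<close> is the standard deviation. Path properties are
  required almost surely only, so path functionals such as suprema over time intervals need not be
  measurable for an incomplete measure. They agree almost everywhere with measurable functions,
  though, and their nonnegative integral is the expectation with respect to the completion.
\<close>

definition brownian_motion ::
  "'a measure \<Rightarrow> (real \<Rightarrow> 'a measure) \<Rightarrow> (real \<Rightarrow> 'a \<Rightarrow> real) \<Rightarrow> bool" where
  "brownian_motion M F b \<longleftrightarrow>
     adapted_process F b \<and>
     (AE \<omega> in M. b 0 \<omega> = 0) \<and>
     (AE \<omega> in M. continuous_on {0..} (\<lambda>t. b t \<omega>)) \<and>
     (\<forall>s t. 0 \<le> s \<longrightarrow> s < t \<longrightarrow>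
        distributed M lborel (\<lambda>\<omega>. b t \<omega> - b s \<omega>) (normal_density 0 (sqrt (t - s))) \<and>
        prob_space.indep_set M (sets (F s))
          {(\<lambda>\<omega>. b t \<omega> - b s \<omega>) -` A \<inter> space M | A. A \<in> sets borel})"

definition time_change_path :: "(real \<Rightarrow> real) \<Rightarrow> bool" where
  "time_change_path f \<longleftrightarrow> f 0 = 0 \<and> continuous_on {0..} f \<and> strict_mono_on {0..} f \<and>
     filterlim f at_top at_top"

text \<open>For a continuous path \<open>x\<close> the integrand below is continuous when \<open>\<sigma>\<close> is continuous and positive
  and \<open>f\<close> is a time change path, so the integral is an ordinary one.\<close>

definition solves_time_change ::
  "(real \<Rightarrow> real \<Rightarrow> real) \<Rightarrow> (real \<Rightarrow> real) \<Rightarrow> (real \<Rightarrow> real) \<Rightarrow> bool" where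
  "solves_time_change \<sigma> x f \<longleftrightarrow>
     (\<forall>t\<ge>0. f t = integral {0..t} (\<lambda>s. 1 / (\<sigma> (f s) (x s))\<^sup>2))"

definition path_inverse :: "(real \<Rightarrow> real) \<Rightarrow> real \<Rightarrow> real" where
  "path_inverse f = the_inv_into {0..} f"

definition linear_interpolation :: "nat \<Rightarrow> (real \<Rightarrow> real) \<Rightarrow> real \<Rightarrow> real" where
  "linear_interpolation n x t =
     (let k = real_of_int \<lfloor>real n * t\<rfloor>
      in x (k / n) + n * (t - k / n) * (x ((k + 1) / n) - x (k / n)))"

text \<open>
  The same formula without the normalising factor \<open>n\<close> in the slope. It does not reach the value at the
  next grid point (unless \<open>n = 1\<close>), but it appears in the literature as the displayed formula for the
  interpolation.
\<close>

definition unscaled_interpolation :: "nat \<Rightarrow> (real \<Rightarrow> real) \<Rightarrow> real \<Rightarrow> real" where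
  "unscaled_interpolation n x t =
     (let k = real_of_int \<lfloor>real n * t\<rfloor>
      in x (k / n) + (t - k / n) * (x ((k + 1) / n) - x (k / n)))"

text \<open>Values of the Euler scheme at the grid points \<open>k / n\<close>, and the scheme itself. For \<open>t > 0\<close> the
  number \<open>k\<close> is the one with \<open>k / n < t \<le> (k + 1) / n\<close>.\<close>

primrec euler_grid :: "(real \<Rightarrow> real \<Rightarrow> real) \<Rightarrow> (real \<Rightarrow> real) \<Rightarrow> nat \<Rightarrow> nat \<Rightarrow> real" where
  "euler_grid \<sigma> x n 0 = 0"
| "euler_grid \<sigma> x n (Suc k) =
     euler_grid \<sigma> x n k + (1 / n) * (1 / (\<sigma> (euler_grid \<sigma> x n k) (x (k / n)))\<^sup>2)"

definition euler_path :: "(real \<Rightarrow> real \<Rightarrow> real) \<Rightarrow> (real \<Rightarrow> real) \<Rightarrow> nat \<Rightarrow> real \<Rightarrow> real" where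
  "euler_path \<sigma> x n t =
     (let k = nat \<lceil>real n * t\<rceil> - 1
      in euler_grid \<sigma> x n k + (t - k / n) * (1 / (\<sigma> (euler_grid \<sigma> x n k) (x (k / n)))\<^sup>2))"

text \<open>Real powers of extended nonnegative reals, for exponents \<open>r > 0\<close>.\<close>

definition ennreal_powr :: "ennreal \<Rightarrow> real \<Rightarrow> ennreal" where
  "ennreal_powr x r = (if x = \<top> then \<top> else ennreal (enn2real x powr r))"

text \<open>The defining recursion of the Euler scheme.\<close>

lemma euler_path_cell:
  assumes "n > 0" "real k / n < t" "t \<le> real (Suc k) / n"
  shows "euler_path \<sigma> x n t =
    euler_grid \<sigma> x n k + (t - k / n) * (1 / (\<sigma> (euler_grid \<sigma> x n k) (x (k / n)))\<^sup>2)"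
proof -
  have "real k < real n * t" "real n * t \<le> real k + 1"
    using assms by (auto simp: field_simps)
  then have "\<lceil>real n * t\<rceil> = int k + 1"
    by (intro ceiling_unique) auto
  then have "nat \<lceil>real n * t\<rceil> - 1 = k" by simp
  then show ?thesis by (simp add: euler_path_def Let_def)
qed

lemma euler_path_0: "euler_path \<sigma> x n 0 = 0"
  by (simp add: euler_path_def)

lemma euler_path_grid:
  assumes "n > 0"
  shows "euler_path \<sigma> x n (k / n) = euler_grid \<sigma> x n k"
proof (cases k)
  case 0
  then show ?thesis by (simp add: euler_path_0)
next
  case (Suc j)
  have "real j / n < real (Suc j) / n" using assms by (simp add: divide_strict_right_mono)
  from euler_path_cell[OF assms this order_refl] assms
  show ?thesis by (simp add: Suc add_divide_distrib)
qed

lemma euler_path_rec: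
  assumes "n > 0" "t \<in> {real k / n <.. (real k + 1) / n}"
  shows "euler_path \<sigma> x n t = euler_path \<sigma> x n (k / n) +
    (t - k / n) * (1 / (\<sigma> (euler_path \<sigma> x n (k / n)) (x (k / n)))\<^sup>2)"
  using euler_path_cell[of n k t \<sigma> x] assms by (simp add: euler_path_grid add.commute)

text \<open>The explicit formula for the inverse of the Euler scheme.\<close>

lemma strict_mono_on_euler_path:
  assumes n: "n > 0" and pos: "\<And>t y. 0 \<le> t \<Longrightarrow> \<sigma> t y > 0"
  shows "strict_mono_on {0..} (euler_path \<sigma> x n)"
proof -
  let ?g = "euler_grid \<sigma> x n" and ?f = "euler_path \<sigma> x n"
  have g0: "0 \<le> ?g k" for k by (induction k) auto
  define q where "q k = 1 / (\<sigma> (?g k) (x (k / n)))\<^sup>2" for k :: nat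
  have q: "q k > 0" for k using pos[OF g0[of k], of "x (k / n)"] by (simp add: q_def)
  have gm: "mono ?g" by (rule incseq_SucI) auto
  have cell: "\<exists>k. real k / n < t \<and> t \<le> real (Suc k) / n" if "t > 0" for t
  proof -
    have "nat \<lceil>real n * t\<rceil> > 0" using that n by simp
    then obtain k where k: "nat \<lceil>real n * t\<rceil> = Suc k" using gr0_implies_Suc by blast
    then have "\<lceil>real n * t\<rceil> = int k + 1" by linarith
    then have "real k < real n * t" "real n * t \<le> real k + 1" by linarith+
    then show ?thesis using n by (intro exI[of _ k]) (simp add: field_simps)
  qed
  have pos_f: "?g k < ?f t \<and> ?f t \<le> ?g (Suc k)" if "real k / n < t" "t \<le> real (Suc k) / n" for k t
  proof -
    have f: "?f t = ?g k + (t - k / n) * q k"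
      using euler_path_cell[OF n that] by (simp add: q_def)
    have "t - k / n \<le> 1 / n" using that by (simp add: add_divide_distrib)
    then have "(t - k / n) * q k \<le> (1 / n) * q k" using q[of k] by (intro mult_right_mono) auto
    moreover have "0 < (t - k / n) * q k" using that q[of k] by (intro mult_pos_pos) auto
    ultimately show ?thesis using f by (simp add: q_def)
  qed
  show ?thesis
  proof (rule strict_mono_onI)
    fix s t :: real assume st: "s \<in> {0..}" "t \<in> {0..}" "s < t"
    then obtain k where k: "real k / n < t" "t \<le> real (Suc k) / n" using cell[of t] by auto
    show "?f s < ?f t"
    proof (cases "s = 0")
      case True
      then show ?thesis using pos_f[OF k] g0[of k] by (simp add: euler_path_0)
    next
      case False
      then obtain j where j: "real j / n < s" "s \<le> real (Suc j) / n" using cell[of s] st by auto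
      show ?thesis
      proof (cases "j = k")
        case True
        then show ?thesis
          using euler_path_cell[OF n k, of \<sigma> x] euler_path_cell[OF n j, of \<sigma> x] q[of k] st
          by (simp add: q_def[symmetric])
      next
        case False
        have "real j / n < real (Suc k) / n" using j k st by linarith
        then have "j < Suc k" using n by (simp add: divide_less_cancel)
        with False have "Suc j \<le> k" by simp
        then have "?g (Suc j) \<le> ?g k" using gm by (rule monoD[rotated])
        then show ?thesis using pos_f[OF k] pos_f[OF j] by linarith
      qed
    qed
  qed
qed

lemma path_inverse_euler_path:
  assumes n: "n > 0" and pos: "\<And>t y. 0 \<le> t \<Longrightarrow> \<sigma> t y > 0"
    and t: "t \<in> {euler_path \<sigma> x n (real k / n) ..< euler_path \<sigma> x n ((real k + 1) / n)}"
  shows "path_inverse (euler_path \<sigma> x n) t = k / n +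
    (t - euler_path \<sigma> x n (real k / n)) /
      (euler_path \<sigma> x n ((real k + 1) / n) - euler_path \<sigma> x n (real k / n)) * (1 / n)"
proof -
  let ?g = "euler_grid \<sigma> x n" and ?f = "euler_path \<sigma> x n"
  have inj: "inj_on ?f {0..}"
    using strict_mono_on_euler_path[OF n pos] by (rule strict_mono_on_imp_inj_on)
  have fk: "?f (real k / n) = ?g k" "?f ((real k + 1) / n) = ?g (Suc k)"
    using euler_path_grid[OF n, of \<sigma> x k] euler_path_grid[OF n, of \<sigma> x "Suc k"]
    by (simp_all add: add.commute)
  define q where "q = 1 / (\<sigma> (?g k) (x (k / n)))\<^sup>2"
  define c where "c = (t - ?g k) / (?g (Suc k) - ?g k)"
  have d: "?g (Suc k) - ?g k = q / n" by (simp add: q_def)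
  have tk: "?g k \<le> t" "t < ?g (Suc k)" using t fk by auto
  then have "0 < ?g (Suc k) - ?g k" "t - ?g k < ?g (Suc k) - ?g k" by linarith+
  then have c: "0 \<le> c" "c < 1"
    unfolding c_def using tk by (simp_all only: divide_less_eq_1_pos zero_le_divide_iff) auto
  have dq: "q / n > 0" using tk d by linarith
  have cq: "c * (1 / n) * q = t - ?g k" using dq n unfolding c_def d by (auto simp: zero_less_divide_iff)
  have "?f (k / n + c * (1 / n)) = t"
  proof (cases "c = 0")
    case True
    then show ?thesis using cq fk by simp
  next
    case False
    then have "real k / n < k / n + c * (1 / n)" using c n by simp
    moreover have "k / n + c * (1 / n) \<le> real (Suc k) / n"
      using c n by (simp add: add_divide_distrib divide_right_mono)
    ultimately show ?thesis
      using euler_path_cell[OF n, of k "k / n + c * (1 / n)" \<sigma> x] cq by (simp add: q_def)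
  qed
  moreover have "k / n + c * (1 / n) \<in> {0..}" using c n by simp
  ultimately have "path_inverse ?f t = k / n + c * (1 / n)"
    unfolding path_inverse_def using inj by (intro the_inv_into_f_eq) auto
  then show ?thesis using fk by (simp add: c_def)
qed

end

theory Submission
  imports Defs
begin

text \<open>
  Let \<open>H\<close> be an \<open>\<alpha>\<close>-Hoelder constant of the Brownian path on a bounded time interval. By dyadic
  chaining and the Gaussian moments it has finite moments of all orders. The rest of the argument is
  pathwise. Comparing the integrand of \<open>\<phi>\<close> with its frozen value on each cell, a discrete Gronwall
  argument gives \<open>|\<phi> - \<phi>\<^sub>n| = O(n^-1 + (H n^-\<alpha>)^\<beta>) = O((1 + H) n^(-\<alpha>\<beta>))\<close>. Since both functions have
  slope at least \<open>1 / C2\<^sup>2\<close>, the inverses are equally close, and a second use of the Hoelder bound on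
  \<open>\<xi>\<close> turns the rate \<open>n^(-\<alpha>\<beta>)\<close> into \<open>n^(-\<alpha>\<^sup>2\<beta>)\<close>.
\<close>


section \<open>Hoelder continuity from dyadic increments\<close>

text \<open>Each time is approached from below by its dyadic truncations, and the increments of
  \<open>f\<close> along them form a geometric series with ratio \<open>2 powr -\<alpha>\<close>.
  Two times at distance about \<open>1 / 2 ^ m\<close> are joined through their
  level-\<open>m\<close> truncations.\<close>

lemma dyadic_chaining:
  fixes f :: "real \<Rightarrow> real" and \<alpha> A :: real
  assumes cont: "continuous_on {0..1} f" and \<alpha>: "0 < \<alpha>" and A: "0 \<le> A"
    and inc: "\<And>m k. k < 2 ^ m \<Longrightarrow>
      \<bar>f (real (Suc k) / 2 ^ m) - f (real k / 2 ^ m)\<bar> \<le> A * (2 powr -\<alpha>) ^ m"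
    and st: "s \<in> {0..1}" "t \<in> {0..1}"
  shows "\<bar>f s - f t\<bar> \<le> 3 * 2 powr \<alpha> / (1 - 2 powr -\<alpha>) * A * \<bar>s - t\<bar> powr \<alpha>"
proof -
  define r :: real where "r = 2 powr -\<alpha>"
  have r: "0 < r" "r < 1" using \<alpha> by (auto simp: r_def powr_less_one)
  define i where "i m t = nat \<lfloor>2 ^ m * t\<rfloor>" for m :: nat and t :: real
  define d where "d m t = real (i m t) / 2 ^ m" for m :: nat and t :: real
  have i_bounds: "real (i m t) \<le> 2 ^ m * t" "2 ^ m * t < real (i m t) + 1" if "0 \<le> t" for m t
    using that by (simp_all add: i_def)
  have i_le: "i m t \<le> 2 ^ m" if "t \<in> {0..1}" for m t
  proof -
    have "real (i m t) \<le> 2 ^ m * t" using i_bounds that by auto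
    also have "\<dots> \<le> real (2 ^ m)" using that by (simp add: mult_left_le)
    finally show ?thesis by (simp only: of_nat_le_iff)
  qed
  have d_step: "\<bar>f (d (Suc m) t) - f (d m t)\<bar> \<le> A * r ^ Suc m" if t: "t \<in> {0..1}" for m t
  proof -
    let ?k = "i m t"
    have "real (2 * ?k) \<le> 2 ^ Suc m * t" "2 ^ Suc m * t < real (2 * ?k) + 2"
      using i_bounds[of t m] t by auto
    then have "real (2 * ?k) < real (i (Suc m) t) + 1" "real (i (Suc m) t) < real (2 * ?k) + 2"
      using i_bounds[of t "Suc m"] t by auto
    \<comment> \<open>The next binary digit is 0 or 1: either the truncation does not move, or it
      moves to the right neighbour on the finer grid, and \<open>inc\<close> applies.\<close>
    then have "i (Suc m) t = 2 * ?k \<or> i (Suc m) t = Suc (2 * ?k)" by linarith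
    then show ?thesis
    proof
      assume "i (Suc m) t = 2 * ?k"
      then show ?thesis using A r by (simp add: d_def)
    next
      assume e: "i (Suc m) t = Suc (2 * ?k)"
      with i_le[OF t, of "Suc m"] have "2 * ?k < 2 ^ Suc m" by simp
      from inc[OF this] show ?thesis unfolding d_def e r_def by simp
    qed
  qed
  have d_diff: "\<bar>f (d (m + j) t) - f (d m t)\<bar> \<le> A * ((r ^ m - r ^ (m + j)) / (1 - r))"
    if t: "t \<in> {0..1}" for m j t
  proof (induction j)
    case (Suc j)
    \<comment> \<open>The quotient is the sum of \<open>r ^ l\<close> for l from m to m + j - 1, so
      the step bound \<open>A * r ^ Suc l\<close> is weakened to \<open>A * r ^ l\<close>.\<close>
    have "(r ^ m - r ^ (m + Suc j)) / (1 - r) = (r ^ m - r ^ (m + j)) / (1 - r) + r ^ (m + j)"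
      using r by (simp add: field_simps)
    moreover have "A * r ^ Suc (m + j) \<le> A * r ^ (m + j)"
      using A r by (intro mult_left_mono power_decreasing) auto
    ultimately show ?case
      using Suc d_step[OF t, of "m + j"] by (simp add: distrib_left)
  qed simp
  have d_tendsto: "(\<lambda>m. d m t) \<longlonglongrightarrow> t" if t: "0 \<le> t" for t
  proof (rule tendsto_sandwich)
    show "(\<lambda>m. t - (1 / 2) ^ m) \<longlonglongrightarrow> t"
      by (rule tendsto_eq_intros LIMSEQ_power_zero | simp)+
    show "\<forall>\<^sub>F m in sequentially. t - (1 / 2) ^ m \<le> d m t"
    proof (rule always_eventually, rule allI)
      fix m
      have "2 ^ m * t / 2 ^ m \<le> (real (i m t) + 1) / 2 ^ m"
        using i_bounds(2)[OF t, of m] by (intro divide_right_mono) auto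
      then show "t - (1 / 2) ^ m \<le> d m t" by (simp add: d_def add_divide_distrib power_one_over)
    qed
    show "\<forall>\<^sub>F m in sequentially. d m t \<le> t"
      using i_bounds(1)[OF t] by (intro always_eventually allI) (simp add: d_def field_simps)
  qed auto
  have d_lim: "\<bar>f t - f (d m t)\<bar> \<le> A * (r ^ m / (1 - r))" if t: "t \<in> {0..1}" for m t
  proof (rule LIMSEQ_le_const2)
    have "d j t \<in> {0..1}" for j
      using of_nat_mono[OF i_le[OF t, of j], where 'a=real] by (simp add: d_def)
    then have "(\<lambda>j. f (d j t)) \<longlonglongrightarrow> f t"
      using cont d_tendsto t by (simp add: continuous_on_sequentially comp_def)
    from LIMSEQ_ignore_initial_segment[OF this, of m]
    have "(\<lambda>j. f (d (m + j) t)) \<longlonglongrightarrow> f t" by (simp add: add.commute)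
    then show "(\<lambda>j. \<bar>f (d (m + j) t) - f (d m t)\<bar>) \<longlonglongrightarrow> \<bar>f t - f (d m t)\<bar>"
      by (intro tendsto_intros)
    have "A * ((r ^ m - r ^ (m + j)) / (1 - r)) \<le> A * (r ^ m / (1 - r))" for j
      using A r by (intro mult_left_mono divide_right_mono) auto
    then show "\<exists>N. \<forall>j\<ge>N. \<bar>f (d (m + j) t) - f (d m t)\<bar> \<le> A * (r ^ m / (1 - r))"
      using d_diff[OF t, of m] order_trans by blast
  qed
  have near: "\<bar>f s - f t\<bar> \<le> 3 / (1 - r) * A * r ^ m"
    if st: "s \<in> {0..1}" "t \<in> {0..1}" and le: "s \<le> t" "t - s \<le> 1 / 2 ^ m" for s t m
  proof -
    have "2 ^ m * s \<le> 2 ^ m * t" "2 ^ m * t \<le> 2 ^ m * s + 1" using le by (auto simp: field_simps)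
    moreover have "real (i m s) \<le> 2 ^ m * s" "2 ^ m * s < real (i m s) + 1"
      "real (i m t) \<le> 2 ^ m * t" "2 ^ m * t < real (i m t) + 1"
      using i_bounds st by auto
    ultimately have "real (i m s) < real (i m t) + 1" "real (i m t) < real (i m s) + 2"
      by linarith+
    then consider "i m t = i m s" | "i m t = Suc (i m s)" by linarith
    then have "\<bar>f (d m t) - f (d m s)\<bar> \<le> A * r ^ m"
    proof cases
      case 1
      then show ?thesis using A r by (simp add: d_def)
    next
      case 2
      then have "i m s < 2 ^ m" using i_le[OF st(2), of m] by simp
      from inc[OF this] show ?thesis unfolding d_def 2 r_def .
    qed
    \<comment> \<open>The bridging increment is enlarged to the size of the two tails from
      \<open>d_lim\<close>; this is the source of the factor 3.\<close>
    moreover have "A * r ^ m \<le> A * (r ^ m / (1 - r))"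
      using A r by (intro mult_left_mono) (auto simp: field_simps)
    ultimately have "\<bar>f s - f t\<bar> \<le> 3 * (A * (r ^ m / (1 - r)))"
      using d_lim[OF st(1), of m] d_lim[OF st(2), of m] by linarith
    then show ?thesis by simp
  qed
  have main: "\<bar>f s - f t\<bar> \<le> 3 * 2 powr \<alpha> / (1 - r) * A * \<bar>s - t\<bar> powr \<alpha>"
    if st: "s \<in> {0..1}" "t \<in> {0..1}" and lt: "s < t" for s t
  proof -
    have "\<exists>n. 1 / 2 ^ n < t - s"
      using real_arch_pow_inv[of "t - s" "1 / 2"] lt by (auto simp: power_one_over)
    \<comment> \<open>With \<open>n\<close> minimal and \<open>m\<close> its predecessor,
      \<open>t - s\<close> lies in the interval from \<open>1 / 2 ^ n\<close> (exclusive) to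
      \<open>1 / 2 ^ m\<close>. The upper end permits \<open>near\<close>; the lower end turns
      \<open>r ^ m\<close> into a power of \<open>t - s\<close> at the cost of
      \<open>2 powr \<alpha>\<close>.\<close>
    then obtain n where n: "1 / 2 ^ n < t - s" "\<And>l. l < n \<Longrightarrow> \<not> 1 / 2 ^ l < t - s"
      using exists_least_iff[of "\<lambda>n. 1 / 2 ^ n < t - s"] by auto
    have "n \<noteq> 0" using n st by (cases n) auto
    then obtain m where m: "n = Suc m" using not0_implies_Suc by blast
    have "r ^ m = 2 powr \<alpha> * (1 / 2 ^ n) powr \<alpha>"
      unfolding m r_def
      by (simp add: powr_powr powr_divide powr_mult powr_minus power_divide field_simps
        flip: powr_realpow powr_add)
    also have "\<dots> \<le> 2 powr \<alpha> * (t - s) powr \<alpha>"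
      using n(1) \<alpha> by (intro mult_left_mono powr_mono2) auto
    finally have "3 / (1 - r) * A * r ^ m \<le> 3 / (1 - r) * A * (2 powr \<alpha> * (t - s) powr \<alpha>)"
      using A r by (intro mult_left_mono) auto
    moreover have "\<bar>f s - f t\<bar> \<le> 3 / (1 - r) * A * r ^ m"
      using n(2)[of m] lt st m by (intro near) auto
    ultimately show ?thesis using lt by (simp add: abs_minus_commute mult_ac)
  qed
  consider "s < t" | "t < s" | "s = t" by linarith
  then show ?thesis
    using main[of s t] main[of t s] st by cases (auto simp: r_def abs_minus_commute)
qed

section \<open>Moments of the Hoelder constant of a Brownian path\<close>

lemma brownian_measurable:
  assumes "filtered_prob_space M F" "brownian_motion M F b" "0 \<le> t"
  shows "b t \<in> borel_measurable M"
proof -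
  have "subalgebra M (F t)" "b t \<in> borel_measurable (F t)"
    using assms by (auto simp: filtered_prob_space_def brownian_motion_def adapted_process_def)
  then show ?thesis by (rule measurable_from_subalg)
qed

text \<open>An even exponent keeps the integrand nonnegative without absolute values, so the
  nonnegative integral equals the Bochner integral, whose value is the known central moment of the
  normal density.\<close>

lemma brownian_even_moment:
  assumes "brownian_motion M F b" "0 \<le> s" "s < t"
  shows "(\<integral>\<^sup>+\<omega>. ennreal ((b t \<omega> - b s \<omega>) ^ (2 * j)) \<partial>M)
    = ennreal (fact (2 * j) / (2 ^ j * fact j) * (t - s) ^ j)"
proof -
  define v where "v = sqrt (t - s)"
  have v: "v > 0" "v\<^sup>2 = t - s" using assms by (auto simp: v_def)
  have d: "distributed M lborel (\<lambda>\<omega>. b t \<omega> - b s \<omega>) (normal_density 0 v)"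
    using assms unfolding brownian_motion_def v_def by blast
  have "(\<integral>\<^sup>+\<omega>. ennreal ((b t \<omega> - b s \<omega>) ^ (2 * j)) \<partial>M)
      = (\<integral>\<^sup>+x. ennreal (normal_density 0 v x) * ennreal (x ^ (2 * j)) \<partial>lborel)"
    by (rule distributed_nn_integral[OF d, symmetric]) simp
  also have "\<dots> = (\<integral>\<^sup>+x. ennreal (normal_density 0 v x * (x - 0) ^ (2 * j)) \<partial>lborel)"
    by (intro nn_integral_cong) (simp add: ennreal_mult'' zero_le_even_power)
  also have "\<dots> = ennreal (fact (2 * j) / ((2 / v\<^sup>2) ^ j * fact j))"
    using normal_moment_even[OF v(1), of 0 j]
    by (intro nn_integral_eq_integral[THEN trans])
      (auto simp: has_bochner_integral_iff zero_le_even_power)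
  also have "fact (2 * j) / ((2 / v\<^sup>2) ^ j * fact j) = fact (2 * j) / (2 ^ j * fact j) * (t - s) ^ j"
    by (simp add: v power_divide)
  finally show ?thesis .
qed

lemma one_plus_power_le:
  fixes h :: real
  assumes "0 \<le> h"
  shows "(1 + h) ^ n \<le> 2 ^ n * (1 + h ^ n)"
proof -
  have "(1 + h) ^ n \<le> (2 * max 1 h) ^ n" using assms by (intro power_mono) auto
  also have "\<dots> = 2 ^ n * max 1 h ^ n" by (rule power_mult_distrib)
  also have "max 1 h ^ n \<le> 1 + h ^ n" using assms by (simp add: max_def)
  finally show ?thesis by simp
qed

text \<open>One random series \<open>G\<close> controls all dyadic increments at once. Its
  expectation is a convergent geometric series, and the \<open>2 * j\<close>-th root of
  \<open>G\<close> is, up to a factor, the Hoelder constant given by chaining.\<close>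

lemma brownian_holder_constant:
  fixes b :: "real \<Rightarrow> 'a \<Rightarrow> real" and \<alpha> R p :: real
  assumes fps: "filtered_prob_space M F" and bm: "brownian_motion M F b"
    and \<alpha>: "0 < \<alpha>" "\<alpha> < 1 / 2" and R: "0 < R"
  obtains H where "H \<in> borel_measurable M" and "\<And>\<omega>. 0 \<le> H \<omega>"
    and "(\<integral>\<^sup>+\<omega>. ennreal ((1 + H \<omega>) powr p) \<partial>M) < \<top>"
    and "AE \<omega> in M. \<forall>s\<in>{0..R}. \<forall>t\<in>{0..R}. \<bar>b s \<omega> - b t \<omega>\<bar> \<le> H \<omega> * \<bar>s - t\<bar> powr \<alpha>"
proof -
  interpret prob_space M using fps by (simp add: filtered_prob_space_def)
  \<comment> \<open>The moment order \<open>2 * j\<close> must dominate \<open>p\<close>, and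
    \<open>j * (1 - 2 * \<alpha>) > 1\<close> is what makes the ratio \<rho> below smaller than
    1.\<close>
  obtain j :: nat where j: "max (max p 1) (1 / (1 - 2 * \<alpha>)) < real j"
    using reals_Archimedean2 by blast
  then have jp: "p \<le> real (2 * j)" and j0: "0 < j" and j1: "1 < real j * (1 - 2 * \<alpha>)"
    using \<alpha> by (auto simp: field_simps)
  define u :: real where "u = 2 powr -\<alpha>"
  have u: "u > 0" by (simp add: u_def)
  define D where "D m k \<omega> = b (R * (real (Suc k) / 2 ^ m)) \<omega> - b (R * (real k / 2 ^ m)) \<omega>"
    for m k :: nat and \<omega>
  \<comment> \<open>A sum of nonnegative terms over all levels and cells dominates each of them;
    this replaces a maximum over increments and is easy to integrate.\<close>
  define G where "G \<omega> = (\<Sum>m. \<Sum>k<2 ^ m. ennreal ((D m k \<omega> / u ^ m) ^ (2 * j)))" for \<omega>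
  have [measurable]: "D m k \<in> borel_measurable M" for m k
    unfolding D_def using R
    by (intro borel_measurable_diff brownian_measurable[OF fps bm]) auto
  have [measurable]: "G \<in> borel_measurable M" unfolding G_def by measurable
  define c :: real where "c = fact (2 * j) / (2 ^ j * fact j)"
  have c: "c \<ge> 0" by (simp add: c_def)
  \<comment> \<open>Level m has \<open>2 ^ m\<close> cells. Each contributes
    \<open>c * (R / 2 ^ m) ^ j / u ^ (2 * j * m)\<close>, so the level as a whole contributes
    \<open>c * R ^ j * \<rho> ^ m\<close>.\<close>
  define \<rho> :: real where "\<rho> = 2 / (2 * u\<^sup>2) ^ j"
  have "2 * u\<^sup>2 = 2 powr (1 - 2 * \<alpha>)"
    by (simp add: u_def powr_powr powr_diff powr_minus divide_simps mult.commute flip: powr_realpow)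
  then have "(2 * u\<^sup>2) ^ j = 2 powr (real j * (1 - 2 * \<alpha>))"
    by (simp add: powr_powr mult.commute flip: powr_realpow)
  also have "\<dots> > 2 powr 1" using j1 by (intro powr_less_mono) auto
  finally have \<rho>: "0 \<le> \<rho>" "\<rho> < 1" using u by (auto simp: \<rho>_def divide_less_eq)
  have D_int: "(\<integral>\<^sup>+\<omega>. ennreal ((D m k \<omega> / u ^ m) ^ (2 * j)) \<partial>M)
      = ennreal (c * (R / 2 ^ m) ^ j / (u ^ m) ^ (2 * j))" for m k
  proof -
    have "(\<integral>\<^sup>+\<omega>. ennreal ((D m k \<omega> / u ^ m) ^ (2 * j)) \<partial>M)
        = (\<integral>\<^sup>+\<omega>. ennreal (1 / (u ^ m) ^ (2 * j)) * ennreal (D m k \<omega> ^ (2 * j)) \<partial>M)"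
      using u by (intro nn_integral_cong) (simp add: power_divide zero_le_even_power flip: ennreal_mult)
    also have "\<dots> = ennreal (1 / (u ^ m) ^ (2 * j)) * (\<integral>\<^sup>+\<omega>. ennreal (D m k \<omega> ^ (2 * j)) \<partial>M)"
      by (rule nn_integral_cmult) measurable
    also have "(\<integral>\<^sup>+\<omega>. ennreal (D m k \<omega> ^ (2 * j)) \<partial>M)
        = ennreal (c * (R * (real (Suc k) / 2 ^ m) - R * (real k / 2 ^ m)) ^ j)"
      unfolding D_def c_def using R
      by (intro brownian_even_moment[OF bm]) (auto simp: field_simps)
    also have "R * (real (Suc k) / 2 ^ m) - R * (real k / 2 ^ m) = R / 2 ^ m"
      by (simp add: field_simps)
    finally show ?thesis using u c R by (simp flip: ennreal_mult)
  qed
  have "(\<integral>\<^sup>+\<omega>. G \<omega> \<partial>M) = (\<Sum>m. \<Sum>k<(2::nat) ^ m. ennreal (c * (R / 2 ^ m) ^ j / (u ^ m) ^ (2 * j)))"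
    unfolding G_def by (subst nn_integral_suminf) (simp_all add: nn_integral_sum D_int del: sum_ennreal)
  also have "\<dots> = (\<Sum>m. ennreal (c * R ^ j * \<rho> ^ m))"
  proof (intro suminf_cong)
    fix m
    have "(\<Sum>k<(2::nat) ^ m. ennreal (c * (R / 2 ^ m) ^ j / (u ^ m) ^ (2 * j)))
        = ennreal (\<Sum>k<(2::nat) ^ m. c * (R / 2 ^ m) ^ j / (u ^ m) ^ (2 * j))"
      using c u R by (intro sum_ennreal) auto
    also have "(\<Sum>k<(2::nat) ^ m. c * (R / 2 ^ m) ^ j / (u ^ m) ^ (2 * j)) = c * R ^ j * \<rho> ^ m"
      by (simp add: \<rho>_def power_divide power_mult_distrib field_simps flip: power_mult)
    finally show "(\<Sum>k<(2::nat) ^ m. ennreal (c * (R / 2 ^ m) ^ j / (u ^ m) ^ (2 * j)))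
        = ennreal (c * R ^ j * \<rho> ^ m)" .
  qed
  also have "\<dots> \<noteq> \<top>"
    using \<rho> c R by (intro ennreal_suminf_neq_top summable_mult summable_geometric) auto
  finally have G_int: "(\<integral>\<^sup>+\<omega>. G \<omega> \<partial>M) \<noteq> \<top>" .
  \<comment> \<open>The chaining constant on the unit interval, divided by
    \<open>R powr \<alpha>\<close> because time is rescaled from [0, R] to [0, 1].\<close>
  define d where "d = 3 * 2 powr \<alpha> / (1 - 2 powr -\<alpha>) / R powr \<alpha>"
  have "2 powr -\<alpha> < 1" using \<alpha> by (simp add: powr_less_one)
  then have d: "d \<ge> 0" by (simp add: d_def)
  \<comment> \<open>Where \<open>G\<close> is infinite, \<open>enn2real\<close> returns 0, so
    \<open>A\<close> is a finite nonnegative number everywhere. The increment bound is claimed only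
    where \<open>G\<close> is finite, which is almost surely the case.\<close>
  define A where "A \<omega> = enn2real (G \<omega>) powr (1 / real (2 * j))" for \<omega>
  define H where "H \<omega> = d * A \<omega>" for \<omega>
  have A0: "0 \<le> A \<omega>" for \<omega> by (simp add: A_def)
  have A_pow: "A \<omega> ^ (2 * j) = enn2real (G \<omega>)" for \<omega>
  proof (cases "enn2real (G \<omega>) = 0")
    case True
    then show ?thesis using j0 by (simp add: A_def)
  next
    case False
    then have pos: "0 < enn2real (G \<omega>)" by (simp add: less_le)
    then have "A \<omega> ^ (2 * j) = A \<omega> powr real (2 * j)"
      by (intro powr_realpow[symmetric]) (simp add: A_def)
    also have "\<dots> = enn2real (G \<omega>)" using pos j0 by (simp add: A_def powr_powr)
    finally show ?thesis .
  qed
  show ?thesis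
  proof (rule that[of H])
    show "H \<in> borel_measurable M" unfolding H_def A_def by measurable
    show H0: "0 \<le> H \<omega>" for \<omega> using d A0 by (simp add: H_def)
    have "ennreal ((1 + H \<omega>) powr p) \<le> ennreal (2 ^ (2 * j)) + ennreal (2 ^ (2 * j) * d ^ (2 * j)) * G \<omega>" for \<omega>
    proof -
      have "(1 + H \<omega>) powr p \<le> (1 + H \<omega>) powr real (2 * j)"
        using H0 jp by (intro powr_mono) auto
      also have "\<dots> = (1 + H \<omega>) ^ (2 * j)"
        using H0[of \<omega>] by (intro powr_realpow) auto
      also have "\<dots> \<le> 2 ^ (2 * j) * (1 + H \<omega> ^ (2 * j))" by (rule one_plus_power_le[OF H0])
      also have "\<dots> = 2 ^ (2 * j) + 2 ^ (2 * j) * d ^ (2 * j) * enn2real (G \<omega>)"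
        by (simp only: H_def power_mult_distrib A_pow) (simp add: algebra_simps)
      finally have "ennreal ((1 + H \<omega>) powr p)
          \<le> ennreal (2 ^ (2 * j) + 2 ^ (2 * j) * d ^ (2 * j) * enn2real (G \<omega>))"
        by (rule ennreal_leI)
      also have "\<dots> = ennreal (2 ^ (2 * j)) + ennreal (2 ^ (2 * j) * d ^ (2 * j)) * ennreal (enn2real (G \<omega>))"
        using d by (subst ennreal_plus) (auto simp: ennreal_mult)
      also have "\<dots> \<le> ennreal (2 ^ (2 * j)) + ennreal (2 ^ (2 * j) * d ^ (2 * j)) * G \<omega>"
        by (intro add_left_mono mult_left_mono) (cases "G \<omega>", auto)
      finally show ?thesis .
    qed
    then have "(\<integral>\<^sup>+\<omega>. ennreal ((1 + H \<omega>) powr p) \<partial>M)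
        \<le> (\<integral>\<^sup>+\<omega>. ennreal (2 ^ (2 * j)) + ennreal (2 ^ (2 * j) * d ^ (2 * j)) * G \<omega> \<partial>M)"
      by (intro nn_integral_mono)
    also have "\<dots> = ennreal (2 ^ (2 * j)) + ennreal (2 ^ (2 * j) * d ^ (2 * j)) * (\<integral>\<^sup>+\<omega>. G \<omega> \<partial>M)"
      by (simp add: nn_integral_add nn_integral_cmult emeasure_space_1)
    also have "\<dots> < \<top>" using G_int by (auto simp: ennreal_mult_less_top less_top)
    finally show "(\<integral>\<^sup>+\<omega>. ennreal ((1 + H \<omega>) powr p) \<partial>M) < \<top>" .
    have "AE \<omega> in M. G \<omega> \<noteq> \<top>" using nn_integral_PInf_AE[of G M] G_int by simp
    moreover have "AE \<omega> in M. continuous_on {0..} (\<lambda>t. b t \<omega>)"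
      using bm by (simp add: brownian_motion_def)
    ultimately show "AE \<omega> in M. \<forall>s\<in>{0..R}. \<forall>t\<in>{0..R}.
        \<bar>b s \<omega> - b t \<omega>\<bar> \<le> H \<omega> * \<bar>s - t\<bar> powr \<alpha>"
    proof eventually_elim
      case (elim \<omega>)
      have inc: "\<bar>b (R * (real (Suc k) / 2 ^ m)) \<omega> - b (R * (real k / 2 ^ m)) \<omega>\<bar>
          \<le> A \<omega> * (2 powr -\<alpha>) ^ m" if "k < 2 ^ m" for m k
      proof -
        have "ennreal ((D m k \<omega> / u ^ m) ^ (2 * j)) \<le> (\<Sum>k<2 ^ m. ennreal ((D m k \<omega> / u ^ m) ^ (2 * j)))"
          using that by (intro member_le_sum) auto
        also have "\<dots> \<le> G \<omega>" unfolding G_def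
          using sum_le_suminf[of "\<lambda>m. \<Sum>k<2 ^ m. ennreal ((D m k \<omega> / u ^ m) ^ (2 * j))" "{m}"]
          by (simp add: summableI)
        also have "\<dots> = ennreal (A \<omega> ^ (2 * j))" using elim by (simp add: A_pow less_top)
        finally have "(\<bar>D m k \<omega>\<bar> / u ^ m) ^ (2 * j) \<le> A \<omega> ^ (2 * j)"
          using A0 by (simp add: power_divide power_even_abs)
        then have "\<bar>D m k \<omega>\<bar> / u ^ m \<le> A \<omega>" 
          using power_mono_iff[of "\<bar>D m k \<omega>\<bar> / u ^ m" "A \<omega>" "2 * j"] j0 A0 u by simp
        then show ?thesis using u unfolding u_def[symmetric] D_def by (simp add: field_simps)
      qed
      show ?case
      proof (intro ballI)
        fix s t assume st: "s \<in> {0..R}" "t \<in> {0..R}"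
        have "continuous_on {0..1} (\<lambda>x. b (R * x) \<omega>)"
          using R by (intro continuous_on_compose2[OF elim(2)] continuous_intros) auto
        from dyadic_chaining[OF this \<alpha>(1) A0 inc, of "s / R" "t / R"]
        have "\<bar>b s \<omega> - b t \<omega>\<bar>
            \<le> 3 * 2 powr \<alpha> / (1 - 2 powr -\<alpha>) * A \<omega> * \<bar>s / R - t / R\<bar> powr \<alpha>"
          using st R by (simp add: divide_le_eq)
        also have "\<bar>s / R - t / R\<bar> = \<bar>s - t\<bar> / R" using R by (simp flip: diff_divide_distrib)
        finally show "\<bar>b s \<omega> - b t \<omega>\<bar> \<le> H \<omega> * \<bar>s - t\<bar> powr \<alpha>"
          using R by (simp add: H_def d_def powr_divide)
      qed
    qed
  qed
qed

section \<open>Elementary inequalities\<close>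

lemma abs_diff_inverse_square_le:
  fixes c :: real
  assumes c: "0 < c" and u: "c \<le> u" "u \<le> C" and v: "c \<le> v" "v \<le> C"
  shows "\<bar>1 / u\<^sup>2 - 1 / v\<^sup>2\<bar> \<le> 2 * C / c ^ 4 * \<bar>u - v\<bar>"
proof -
  have "1 / u\<^sup>2 - 1 / v\<^sup>2 = (u + v) / (u\<^sup>2 * v\<^sup>2) * (v - u)"
    using assms by (simp add: field_simps power2_eq_square)
  then have "\<bar>1 / u\<^sup>2 - 1 / v\<^sup>2\<bar> = (u + v) / (u\<^sup>2 * v\<^sup>2) * \<bar>u - v\<bar>"
    using assms by (simp add: abs_mult abs_minus_commute)
  also have "\<dots> \<le> 2 * C / (c\<^sup>2 * c\<^sup>2) * \<bar>u - v\<bar>"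
    using assms by (intro mult_right_mono frac_le mult_mono power_mono) auto
  finally show ?thesis by (simp flip: power_add)
qed

text \<open>Trades fractional powers of the random Hoelder constant for integer ones, so that the
  final pathwise bound is a multiple of \<open>(1 + H)\<^sup>2\<close>.\<close>

lemma powr_le_one_plus:
  fixes y a :: real
  assumes "0 \<le> y" "0 \<le> a" "a \<le> 1"
  shows "y powr a \<le> 1 + y"
proof (cases "y \<le> 1")
  case True
  then show ?thesis using powr_le1[of a y] assms by linarith
next
  case False
  then have "y powr a \<le> y powr 1" using assms by (intro powr_mono) auto
  then show ?thesis using False by simp
qed

section \<open>The deterministic setting along one path\<close>

text \<open>Everything random is frozen: \<open>x\<close> is a path of \<xi> and \<open>H\<close>
  its Hoelder constant on [0, R]. Both \<phi> and its Euler scheme have slope at most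
  \<open>1 / C1\<^sup>2\<close>, so up to time \<open>R\<close> their values stay in
  \<open>{0..R / C1\<^sup>2}\<close>, where \<open>\<sigma>_diff\<close> is available.\<close>

locale euler_time_change =
  fixes \<sigma> :: "real \<Rightarrow> real \<Rightarrow> real" and x \<phi> :: "real \<Rightarrow> real"
    and C1 C2 L C \<beta> \<alpha> H R :: real and n :: nat
  assumes C1: "0 < C1"
    and \<sigma>_bounds: "\<And>t y. 0 \<le> t \<Longrightarrow> C1 \<le> \<sigma> t y \<and> \<sigma> t y \<le> C2"
    and \<beta>: "0 < \<beta>" "\<beta> \<le> 1" and \<alpha>: "0 < \<alpha>" "\<alpha> \<le> 1"
    and nonneg: "0 \<le> L" "0 \<le> C" "0 \<le> H"
    and \<sigma>_diff: "\<And>s t y z. s \<in> {0..R / C1\<^sup>2} \<Longrightarrow> t \<in> {0..R / C1\<^sup>2} \<Longrightarrow>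
      \<bar>\<sigma> s y - \<sigma> t z\<bar> \<le> L * \<bar>s - t\<bar> + C * \<bar>y - z\<bar> powr \<beta>"
    and x_holder: "\<And>s t. s \<in> {0..R} \<Longrightarrow> t \<in> {0..R} \<Longrightarrow> \<bar>x s - x t\<bar> \<le> H * \<bar>s - t\<bar> powr \<alpha>"
    and time_change: "time_change_path \<phi>"
    and solves: "solves_time_change \<sigma> x \<phi>"
    and n: "0 < n"
begin

abbreviation "g \<equiv> euler_grid \<sigma> x n"
abbreviation "\<phi>\<^sub>n \<equiv> euler_path \<sigma> x n"

definition "speed t = 1 / (\<sigma> (\<phi> t) (x t))\<^sup>2"
definition "grid_speed k = 1 / (\<sigma> (g k) (x (k / n)))\<^sup>2"

text \<open>\<open>D\<close> is the Lipschitz constant of the inverse square between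
  \<open>C1\<close> and \<open>C2\<close>. \<open>B\<close> bounds the change of the speed caused
  within one cell, where \<phi> moves by at most \<open>1 / (C1\<^sup>2 * n)\<close> and
  \<open>x\<close> by at most \<open>H * (1 / n) powr \<alpha>\<close>.\<close>

definition "D = 2 * C2 / C1 ^ 4"
definition "B = D * (L / (C1\<^sup>2 * n) + C * (H * (1 / n) powr \<alpha>) powr \<beta>)"

section \<open>Slope bounds for the time change\<close>

lemma C2: "C1 \<le> C2" "0 < C2"
  using C1 \<sigma>_bounds[of 0 0] by auto

lemma D_nonneg: "0 \<le> D" and B_nonneg: "0 \<le> B"
  using C1 C2 nonneg by (auto simp: D_def B_def)

lemma inverse_square_bounds:
  assumes "0 \<le> t"
  shows "1 / C2\<^sup>2 \<le> 1 / (\<sigma> t y)\<^sup>2" "1 / (\<sigma> t y)\<^sup>2 \<le> 1 / C1\<^sup>2"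
  using C1 C2 \<sigma>_bounds[OF assms, of y] by (auto intro!: frac_le power_mono)

lemma phi_0: "\<phi> 0 = 0" and phi_mono: "0 \<le> s \<Longrightarrow> s < t \<Longrightarrow> \<phi> s < \<phi> t"
  and phi_cont: "continuous_on {0..} \<phi>"
  using time_change by (auto simp: time_change_path_def strict_mono_on_def)

lemma phi_nonneg: "0 \<le> t \<Longrightarrow> 0 \<le> \<phi> t"
  using phi_mono[of 0 t] by (cases "t = 0") (auto simp: phi_0)

lemma speed_bounds: "0 \<le> t \<Longrightarrow> 1 / C2\<^sup>2 \<le> speed t" "0 \<le> t \<Longrightarrow> speed t \<le> 1 / C1\<^sup>2"
  using inverse_square_bounds[OF phi_nonneg] by (auto simp: speed_def)

lemma phi_integral: "0 \<le> t \<Longrightarrow> \<phi> t = integral {0..t} speed"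
  using solves by (simp add: solves_time_change_def speed_def[abs_def])

text \<open>The integral of a non-integrable function is \<open>0\<close> by convention, so integrability is read off
  the strict monotonicity of \<open>\<phi>\<close>.\<close>

lemma speed_integrable: "speed integrable_on {0..t}"
proof (cases "t > 0")
  case True
  then have "integral {0..t} speed \<noteq> 0" using phi_mono[of 0 t] phi_integral[of t] by (auto simp: phi_0)
  then show ?thesis using not_integrable_integral by blast
next
  case False
  then show ?thesis using integrable_on_refl[of speed t] by (cases "t = 0") auto
qed

lemma speed_has_integral:
  assumes "0 \<le> s" "s \<le> t"
  shows "(speed has_integral (\<phi> t - \<phi> s)) {s..t}"
proof -
  have "speed integrable_on {s..t}"
    using assms by (intro integrable_on_subinterval[OF speed_integrable[of t]]) auto
  moreover have "integral {0..s} speed + integral {s..t} speed = integral {0..t} speed"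
    using assms speed_integrable by (intro Henstock_Kurzweil_Integration.integral_combine) auto
  ultimately show ?thesis
    using assms by (simp add: has_integral_integrable_integral phi_integral)
qed

text \<open>Integrate the constant bounds on the speed. The lower estimate makes the inverse of
  \<phi> Lipschitz; the upper one controls how far \<phi> moves within a cell.\<close>

lemma phi_increment:
  assumes "0 \<le> s" "s \<le> t"
  shows "(t - s) / C2\<^sup>2 \<le> \<phi> t - \<phi> s" "\<phi> t - \<phi> s \<le> (t - s) / C1\<^sup>2"
proof -
  have "((\<lambda>_. 1 / C2\<^sup>2) has_integral (t - s) / C2\<^sup>2) {s..t}"
    using has_integral_const_real[of "1 / C2\<^sup>2" s t] assms by simp
  from has_integral_le[OF this speed_has_integral[OF assms]]
  show "(t - s) / C2\<^sup>2 \<le> \<phi> t - \<phi> s" using assms speed_bounds by auto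
  have "((\<lambda>_. 1 / C1\<^sup>2) has_integral (t - s) / C1\<^sup>2) {s..t}"
    using has_integral_const_real[of "1 / C1\<^sup>2" s t] assms by simp
  from has_integral_le[OF speed_has_integral[OF assms] this]
  show "\<phi> t - \<phi> s \<le> (t - s) / C1\<^sup>2" using assms speed_bounds by auto
qed

lemma phi_le: "0 \<le> t \<Longrightarrow> \<phi> t \<le> t / C1\<^sup>2" and phi_ge: "0 \<le> t \<Longrightarrow> t / C2\<^sup>2 \<le> \<phi> t"
  using phi_increment[of 0 t] by (auto simp: phi_0)

section \<open>The Euler grid and its slopes\<close>

lemma grid_nonneg: "0 \<le> g k"
  by (induction k) auto

lemma grid_speed_bounds: "1 / C2\<^sup>2 \<le> grid_speed k" "grid_speed k \<le> 1 / C1\<^sup>2"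
  using inverse_square_bounds[OF grid_nonneg] by (auto simp: grid_speed_def)

lemma grid_speed_pos: "0 < grid_speed k"
  using grid_speed_bounds(1)[of k] C2 by (auto intro: less_le_trans[rotated])

lemma grid_Suc: "g (Suc k) = g k + grid_speed k / n"
  by (simp add: grid_speed_def)

lemma grid_le: "g k \<le> k / n / C1\<^sup>2"
proof (induction k)
  case (Suc k)
  have "grid_speed k / n \<le> 1 / C1\<^sup>2 / n" by (intro divide_right_mono grid_speed_bounds) simp
  then show ?case using Suc unfolding grid_Suc by (simp add: add_divide_distrib mult.commute)
qed simp

lemma grid_ge: "k / n / C2\<^sup>2 \<le> g k"
proof (induction k)
  case (Suc k)
  have "1 / C2\<^sup>2 / n \<le> grid_speed k / n" by (intro divide_right_mono grid_speed_bounds) simp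
  then show ?case using Suc unfolding grid_Suc by (simp add: add_divide_distrib mult.commute)
qed simp

text \<open>The left end point is included, so that cells can be treated as closed intervals; there
  the formula reduces to the grid value.\<close>

lemma euler_path_eq:
  assumes "real k / n \<le> t" "t \<le> real (Suc k) / n"
  shows "\<phi>\<^sub>n t = g k + (t - k / n) * grid_speed k"
proof (cases "t = k / n")
  case True
  then show ?thesis by (simp add: euler_path_grid[OF n])
next
  case False
  then show ?thesis using euler_path_cell[OF n, of k t \<sigma> x] assms by (simp add: grid_speed_def)
qed

lemma cell_exists:
  assumes "0 \<le> t"
  obtains k :: nat where "real k / n \<le> t" "t \<le> real (Suc k) / n"
proof -
  have "real (nat \<lfloor>n * t\<rfloor>) \<le> n * t" "n * t \<le> real (Suc (nat \<lfloor>n * t\<rfloor>))"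
    using assms by auto linarith
  then show ?thesis using n by (intro that[of "nat \<lfloor>n * t\<rfloor>"]) (auto simp: field_simps)
qed

lemma euler_path_ge:
  assumes "0 \<le> t"
  shows "t / C2\<^sup>2 \<le> \<phi>\<^sub>n t"
proof -
  obtain k where k: "real k / n \<le> t" "t \<le> real (Suc k) / n" using cell_exists assms .
  have "(t - k / n) * (1 / C2\<^sup>2) \<le> (t - k / n) * grid_speed k"
    using k grid_speed_bounds by (intro mult_left_mono) auto
  then show ?thesis using grid_ge[of k] unfolding euler_path_eq[OF k] by (simp add: diff_divide_distrib)
qed

section \<open>Error of the Euler scheme\<close>

text \<open>On a cell the error grows by the integral of the true speed minus its frozen value. That
  difference is at most \<open>D\<close> times the change of \<sigma>, whose first argument is off
  by the error at \<open>k / n\<close> plus the motion of \<phi> since then.\<close>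

lemma euler_step_error:
  assumes k: "real k / n \<le> t" "t \<le> real (Suc k) / n" and R: "t \<le> R"
  shows "\<bar>\<phi> t - \<phi>\<^sub>n t\<bar>
    \<le> \<bar>\<phi> (k / n) - g k\<bar> + (t - k / n) * (D * L * \<bar>\<phi> (k / n) - g k\<bar> + B)"
proof -
  let ?e = "\<bar>\<phi> (k / n) - g k\<bar>"
  have t0: "0 \<le> real k / n" by simp
  have speed_diff: "\<bar>speed s - grid_speed k\<bar> \<le> D * L * ?e + B" if s: "s \<in> {real k / n..t}" for s
  proof -
    have s0: "0 \<le> s" and sR: "s \<le> R" and kR: "real k / n \<le> R"
      using s t0 k R unfolding atLeastAtMost_iff by linarith+
    have sk: "\<bar>s - k / n\<bar> \<le> 1 / n" using s k by (auto simp: add_divide_distrib)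
    \<comment> \<open>Both first arguments of \<sigma> are placed in the interval on which
      \<open>\<sigma>_diff\<close> is assumed.\<close>
    have "\<phi> s \<le> R / C1\<^sup>2" "g k \<le> R / C1\<^sup>2"
      using order_trans[OF phi_le[OF s0] divide_right_mono[OF sR]]
        order_trans[OF grid_le divide_right_mono[OF kR]] by auto
    then have "\<bar>\<sigma> (\<phi> s) (x s) - \<sigma> (g k) (x (k / n))\<bar>
        \<le> L * \<bar>\<phi> s - g k\<bar> + C * \<bar>x s - x (k / n)\<bar> powr \<beta>"
      using phi_nonneg[OF s0] grid_nonneg by (intro \<sigma>_diff) auto
    also have "\<dots> \<le> L * (?e + 1 / (C1\<^sup>2 * n)) + C * (H * (1 / n) powr \<alpha>) powr \<beta>"
    proof (intro add_mono mult_left_mono powr_mono2)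
      have "\<bar>\<phi> s - \<phi> (k / n)\<bar> \<le> (s - k / n) / C1\<^sup>2"
        using phi_increment(2)[of "k / n" s] phi_mono[of "k / n" s] s
        by (cases "s = k / n") auto
      also have "\<dots> \<le> 1 / n / C1\<^sup>2" using sk by (intro divide_right_mono) auto
      finally show "\<bar>\<phi> s - g k\<bar> \<le> ?e + 1 / (C1\<^sup>2 * n)" by (simp add: mult.commute)
      have "\<bar>x s - x (k / n)\<bar> \<le> H * \<bar>s - k / n\<bar> powr \<alpha>"
        using s0 sR kR by (intro x_holder) auto
      also have "\<dots> \<le> H * (1 / n) powr \<alpha>"
        using sk nonneg \<alpha> by (intro mult_left_mono powr_mono2) auto
      finally show "\<bar>x s - x (k / n)\<bar> \<le> H * (1 / n) powr \<alpha>" .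
    qed (use nonneg \<beta> in auto)
    finally have "\<bar>\<sigma> (\<phi> s) (x s) - \<sigma> (g k) (x (k / n))\<bar>
        \<le> L * (?e + 1 / (C1\<^sup>2 * n)) + C * (H * (1 / n) powr \<alpha>) powr \<beta>" .
    then have "D * \<bar>\<sigma> (\<phi> s) (x s) - \<sigma> (g k) (x (k / n))\<bar>
        \<le> D * (L * (?e + 1 / (C1\<^sup>2 * n)) + C * (H * (1 / n) powr \<alpha>) powr \<beta>)"
      using D_nonneg by (intro mult_left_mono)
    moreover have "\<bar>speed s - grid_speed k\<bar> \<le> D * \<bar>\<sigma> (\<phi> s) (x s) - \<sigma> (g k) (x (k / n))\<bar>"
      unfolding speed_def grid_speed_def D_def
      using \<sigma>_bounds[OF phi_nonneg[OF s0]] \<sigma>_bounds[OF grid_nonneg]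
      by (intro abs_diff_inverse_square_le[OF C1]) auto
    ultimately show ?thesis by (simp add: B_def algebra_simps)
  qed
  \<comment> \<open>The value of this integral is the increment of \<phi> minus that of
    \<open>\<phi>\<^sub>n\<close> over the interval from \<open>k / n\<close> to
    \<open>t\<close>.\<close>
  have "((\<lambda>s. speed s - grid_speed k) has_integral
      (\<phi> t - \<phi> (k / n) - (t - k / n) * grid_speed k)) (cbox (real k / n) t)"
    using has_integral_diff[OF speed_has_integral[OF t0 k(1)]
        has_integral_const_real[of "grid_speed k" "real k / n" t]] k by simp
  from has_integral_bound[OF _ this, of "D * L * ?e + B"]
  have "\<bar>\<phi> t - \<phi> (k / n) - (t - k / n) * grid_speed k\<bar> \<le> (D * L * ?e + B) * (t - k / n)"
    using speed_diff D_nonneg B_nonneg nonneg k by simp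
  then show ?thesis unfolding euler_path_eq[OF k] by (simp add: mult.commute)
qed

text \<open>Discrete Gronwall by induction over the cells. The hypothesis is used at the right end
  of the preceding cell, and \<open>1 + h * (D * L)\<close> is at most the exponential of
  \<open>h * (D * L)\<close>, so the exponentials multiply up. The new term \<open>h * B\<close>
  fits because the exponential is at least 1.\<close>

lemma euler_path_error_cell:
  assumes "real k / n \<le> t" "t \<le> real (Suc k) / n" "t \<le> R"
  shows "\<bar>\<phi> t - \<phi>\<^sub>n t\<bar> \<le> exp (D * L * t) * t * B"
  using assms
proof (induction k arbitrary: t)
  case 0
  have "\<bar>\<phi> t - \<phi>\<^sub>n t\<bar> \<le> 1 * t * B"
    using euler_step_error[OF 0] by (simp add: phi_0)
  also have "\<dots> \<le> exp (D * L * t) * t * B"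
    using 0 D_nonneg B_nonneg nonneg by (intro mult_right_mono) auto
  finally show ?case .
next
  case (Suc k)
  define s where "s = real (Suc k) / n"
  define h where "h = t - s"
  have h: "0 \<le> h" "s + h = t" "0 \<le> s" using Suc.prems by (auto simp: h_def s_def)
  have s: "real k / n \<le> s" "s \<le> real (Suc k) / n" "s \<le> R"
    using Suc.prems n by (auto simp: s_def divide_right_mono)
  have DL: "0 \<le> D * L" using D_nonneg nonneg by simp
  have e: "\<bar>\<phi> s - g (Suc k)\<bar> \<le> exp (D * L * s) * s * B"
    using Suc.IH[OF s] euler_path_grid[OF n, of \<sigma> x "Suc k"] by (simp only: s_def)
  have "\<bar>\<phi> t - \<phi>\<^sub>n t\<bar> \<le> (1 + h * (D * L)) * \<bar>\<phi> s - g (Suc k)\<bar> + h * B"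
    using euler_step_error[OF Suc.prems] unfolding s_def[symmetric] h_def[symmetric]
    by (simp only: distrib_left distrib_right mult_1 mult_ac add_ac)
  also have "\<dots> \<le> exp (h * (D * L)) * (exp (D * L * s) * s * B) + h * B"
    using e h DL by (intro add_right_mono mult_mono exp_ge_add_one_self) auto
  also have "exp (h * (D * L)) * (exp (D * L * s) * s * B) = exp (D * L * t) * s * B"
    unfolding h(2)[symmetric] by (simp add: distrib_left distrib_right exp_add mult_ac)
  also have "h * B \<le> exp (D * L * t) * h * B"
  proof -
    have "0 \<le> D * L * t" using mult_nonneg_nonneg[OF DL, of t] h by simp
    then have "1 * (h * B) \<le> exp (D * L * t) * (h * B)"
      using h B_nonneg by (intro mult_right_mono) auto
    then show ?thesis by (simp only: mult.assoc mult_1)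
  qed
  finally show ?case unfolding h(2)[symmetric] by (simp add: algebra_simps)
qed

text \<open>Contains neither \<open>n\<close> nor the path nor \<open>H\<close>, so the same number
  serves for all sample points and all meshes.\<close>

definition "Q = C2\<^sup>2 * (exp (D * L * R) * R * (D * (L / C1\<^sup>2 + C)))"

text \<open>Both parts of \<open>B\<close> are brought to the common rate: \<open>1 / n\<close> is
  at most \<open>n powr (- (\<alpha> * \<beta>))\<close> since
  \<open>\<alpha> * \<beta> \<le> 1\<close>, and \<open>H powr \<beta> \<le> 1 + H\<close>. The
  factor \<open>C2\<^sup>2\<close> anticipates the passage to the inverses.\<close>

lemma euler_path_error:
  assumes t: "0 \<le> t" "t \<le> R"
  shows "C2\<^sup>2 * \<bar>\<phi> t - \<phi>\<^sub>n t\<bar> \<le> Q * (1 + H) * real n powr (- (\<alpha> * \<beta>))"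
proof -
  let ?N = "real n powr (- (\<alpha> * \<beta>))"
  have DL: "0 \<le> D * L" using D_nonneg nonneg by simp
  have "\<alpha> * \<beta> \<le> 1" using \<alpha> \<beta> by (simp add: mult_le_one)
  then have "real n powr - 1 \<le> ?N" using n by (intro powr_mono) auto
  then have inv: "1 / n \<le> ?N" by (simp add: powr_minus_divide)
  have "(H * (1 / n) powr \<alpha>) powr \<beta> = H powr \<beta> * ?N"
    using nonneg n by (simp add: powr_mult powr_powr powr_divide powr_minus_divide)
  also have "\<dots> \<le> (1 + H) * ?N"
    using nonneg \<beta> by (intro mult_right_mono powr_le_one_plus) auto
  finally have hold: "(H * (1 / n) powr \<alpha>) powr \<beta> \<le> (1 + H) * ?N" .
  have "L / (C1\<^sup>2 * n) = L / C1\<^sup>2 * (1 / n)" by simp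
  also have "\<dots> \<le> L / C1\<^sup>2 * ((1 + H) * ?N)"
    using inv nonneg mult_right_mono[of 1 "1 + H" ?N] by (intro mult_left_mono) auto
  finally have "B \<le> D * (L / C1\<^sup>2 * ((1 + H) * ?N) + C * ((1 + H) * ?N))"
    unfolding B_def using hold nonneg D_nonneg by (intro mult_left_mono add_mono) auto
  also have "\<dots> = D * (L / C1\<^sup>2 + C) * ((1 + H) * ?N)" by (simp only: algebra_simps)
  finally have B: "B \<le> D * (L / C1\<^sup>2 + C) * ((1 + H) * ?N)" .
  obtain k where "real k / n \<le> t" "t \<le> real (Suc k) / n" using cell_exists t(1) .
  then have "\<bar>\<phi> t - \<phi>\<^sub>n t\<bar> \<le> exp (D * L * t) * t * B"
    using t by (intro euler_path_error_cell)
  also have "\<dots> \<le> exp (D * L * R) * R * B"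
    using t DL B_nonneg by (intro mult_mono) (auto intro: mult_left_mono)
  also have "\<dots> \<le> exp (D * L * R) * R * (D * (L / C1\<^sup>2 + C) * ((1 + H) * ?N))"
    using t B by (intro mult_left_mono) auto
  finally have "C2\<^sup>2 * \<bar>\<phi> t - \<phi>\<^sub>n t\<bar>
      \<le> C2\<^sup>2 * (exp (D * L * R) * R * (D * (L / C1\<^sup>2 + C) * ((1 + H) * ?N)))"
    by (intro mult_left_mono) auto
  then show ?thesis by (simp add: Q_def mult_ac)
qed

section \<open>The inverse functions\<close>

text \<open>\<open>path_inverse\<close> is meaningful only at attained values. The intermediate
  value theorem supplies a preimage, since \<phi> has reached \<open>t\<close> by time
  \<open>C2\<^sup>2 * t\<close>.\<close>

lemma phi_inverse:
  assumes "0 \<le> t"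
  shows "0 \<le> path_inverse \<phi> t" "\<phi> (path_inverse \<phi> t) = t"
proof -
  have inj: "inj_on \<phi> {0..}"
    using time_change by (auto simp: time_change_path_def intro: strict_mono_on_imp_inj_on)
  have "t \<le> \<phi> (C2\<^sup>2 * t)" using phi_ge[of "C2\<^sup>2 * t"] assms C2 by simp
  then obtain u where u: "0 \<le> u" "\<phi> u = t"
    using IVT'[of \<phi> 0 t "C2\<^sup>2 * t"] assms continuous_on_subset[OF phi_cont, of "{0..C2\<^sup>2 * t}"]
    by (auto simp: phi_0)
  then have "path_inverse \<phi> t = u"
    unfolding path_inverse_def using inj by (intro the_inv_into_f_eq) auto
  with u show "0 \<le> path_inverse \<phi> t" "\<phi> (path_inverse \<phi> t) = t" by auto
qed

text \<open>The grid values are unbounded by \<open>grid_ge\<close>, so there is a first one above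
  \<open>t\<close>. Solving the linear equation on the cell that ends there gives the
  preimage.\<close>

lemma euler_path_inverse:
  assumes "0 \<le> t"
  shows "0 \<le> path_inverse \<phi>\<^sub>n t" "\<phi>\<^sub>n (path_inverse \<phi>\<^sub>n t) = t"
proof -
  have "\<sigma> s y > 0" if "0 \<le> s" for s y using \<sigma>_bounds[OF that, of y] C1 by linarith
  then have inj: "inj_on \<phi>\<^sub>n {0..}"
    using strict_mono_on_euler_path[OF n] strict_mono_on_imp_inj_on by blast
  obtain m :: nat where m: "n * (C2\<^sup>2 * t) < m" using reals_Archimedean2 by blast
  then have "t < m / n / C2\<^sup>2" using n C2 by (simp add: field_simps)
  then have "t < g m" using grid_ge[of m] by linarith
  then obtain j where j: "t < g j" "\<And>l. l < j \<Longrightarrow> \<not> t < g l"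
    using exists_least_iff[of "\<lambda>m. t < g m"] by auto
  have "j \<noteq> 0" using j assms by (cases j) auto
  then obtain k where k: "j = Suc k" using not0_implies_Suc by blast
  have tk: "g k \<le> t" "t < g k + grid_speed k / n"
    using j(1) j(2)[of k] unfolding k grid_Suc by auto
  define v where "v = k / n + (t - g k) / grid_speed k"
  have "0 \<le> (t - g k) / grid_speed k" "(t - g k) / grid_speed k \<le> 1 / n"
    using tk grid_speed_pos[of k] by (auto simp: field_simps)
  then have v: "real k / n \<le> v" "v \<le> real (Suc k) / n"
    by (auto simp: v_def add_divide_distrib)
  have "0 \<le> v" by (rule order_trans[OF _ v(1)]) simp
  moreover have "\<phi>\<^sub>n v = t" using euler_path_eq[OF v] grid_speed_pos[of k] by (simp add: v_def)
  ultimately have "path_inverse \<phi>\<^sub>n t = v"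
    unfolding path_inverse_def using inj by (intro the_inv_into_f_eq) auto
  with \<open>0 \<le> v\<close> \<open>\<phi>\<^sub>n v = t\<close> show "0 \<le> path_inverse \<phi>\<^sub>n t" "\<phi>\<^sub>n (path_inverse \<phi>\<^sub>n t) = t" by auto
qed

section \<open>Interpolation and the pathwise rate\<close>

text \<open>With or without the factor \<open>n\<close>, the interpolated value is a convex
  combination of the two adjacent grid values, and each of these is within the Hoelder bound of
  \<open>x v\<close>. The room \<open>v + 1 \<le> R\<close> keeps the right grid point inside
  [0, R].\<close>

lemma interpolation_error:
  assumes interp: "interp \<in> {linear_interpolation n, unscaled_interpolation n}"
    and v: "0 \<le> v" "v + 1 \<le> R"
  shows "\<bar>interp x v - x v\<bar> \<le> H * (1 / n) powr \<alpha>"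
proof -
  define k where "k = real_of_int \<lfloor>n * v\<rfloor>"
  have k: "0 \<le> k" "k \<le> n * v" "n * v \<le> k + 1" using v by (auto simp: k_def)
  then have kv: "0 \<le> k / n" "k / n \<le> v" "v \<le> k / n + 1 / n"
    using n by (auto simp: field_simps)
  have n1: "1 / real n \<le> 1" using n by simp
  have near: "\<bar>x s - x v\<bar> \<le> H * (1 / n) powr \<alpha>" if "0 \<le> s" "\<bar>s - v\<bar> \<le> 1 / n" for s
  proof -
    have "\<bar>x s - x v\<bar> \<le> H * \<bar>s - v\<bar> powr \<alpha>"
      using that v n1 by (intro x_holder) auto
    also have "\<dots> \<le> H * (1 / n) powr \<alpha>"
      using that nonneg \<alpha> by (intro mult_left_mono powr_mono2) auto
    finally show ?thesis .
  qed
  have x0: "\<bar>x (k / n) - x v\<bar> \<le> H * (1 / n) powr \<alpha>" using kv by (intro near) auto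
  have x1: "\<bar>x ((k + 1) / n) - x v\<bar> \<le> H * (1 / n) powr \<alpha>"
    using kv by (intro near) (auto simp: add_divide_distrib)
  have "\<exists>\<theta>. 0 \<le> \<theta> \<and> \<theta> \<le> 1 \<and> interp x v = x (k / n) + \<theta> * (x ((k + 1) / n) - x (k / n))"
    using interp
  proof (elim insertE emptyE)
    assume "interp = linear_interpolation n"
    moreover have "0 \<le> n * (v - k / n)" "n * (v - k / n) \<le> 1"
      using k n by (auto simp: right_diff_distrib)
    ultimately show ?thesis by (intro exI[of _ "n * (v - k / n)"])
        (simp add: linear_interpolation_def Let_def k_def)
  next
    assume "interp = unscaled_interpolation n"
    moreover have "0 \<le> v - k / n" "v - k / n \<le> 1" using kv n1 by linarith+
    ultimately show ?thesis by (intro exI[of _ "v - k / n"])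
        (simp add: unscaled_interpolation_def Let_def k_def)
  qed
  then obtain \<theta> where \<theta>: "0 \<le> \<theta>" "\<theta> \<le> 1"
    and eq: "interp x v = x (k / n) + \<theta> * (x ((k + 1) / n) - x (k / n))" by blast
  have "interp x v - x v = (1 - \<theta>) * (x (k / n) - x v) + \<theta> * (x ((k + 1) / n) - x v)"
    unfolding eq by (simp add: algebra_simps)
  then have "\<bar>interp x v - x v\<bar> \<le> (1 - \<theta>) * \<bar>x (k / n) - x v\<bar> + \<theta> * \<bar>x ((k + 1) / n) - x v\<bar>"
    using \<theta> by (metis abs_mult abs_of_nonneg abs_triangle_ineq diff_ge_0_iff_ge)
  also have "\<dots> \<le> (1 - \<theta>) * (H * (1 / n) powr \<alpha>) + \<theta> * (H * (1 / n) powr \<alpha>)"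
    using x0 x1 \<theta> by (intro add_mono mult_left_mono) auto
  finally show ?thesis by (simp add: algebra_simps)
qed

text \<open>Insert \<open>x v\<close> with \<open>v\<close> the inverse of the Euler scheme at
  \<open>t\<close>: one part is the interpolation error, the other the oscillation of
  \<open>x\<close> between the two inverse times.\<close>

lemma pathwise_error:
  assumes interp: "interp \<in> {linear_interpolation n, unscaled_interpolation n}"
    and t: "0 \<le> t" and R: "C2\<^sup>2 * t + 1 \<le> R"
  shows "\<bar>interp x (path_inverse \<phi>\<^sub>n t) - x (path_inverse \<phi> t)\<bar>
    \<le> (2 + Q) * (1 + H)\<^sup>2 * real n powr (- (\<alpha>\<^sup>2 * \<beta>))"
proof -
  define u where "u = path_inverse \<phi> t"
  define v where "v = path_inverse \<phi>\<^sub>n t"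
  let ?N = "real n powr (- (\<alpha>\<^sup>2 * \<beta>))"
  have u: "0 \<le> u" "\<phi> u = t" using phi_inverse[OF t] by (auto simp: u_def)
  have v: "0 \<le> v" "\<phi>\<^sub>n v = t" using euler_path_inverse[OF t] by (auto simp: v_def)
  have "u / C2\<^sup>2 \<le> t" "v / C2\<^sup>2 \<le> t" using phi_ge[OF u(1)] euler_path_ge[OF v(1)] u v by auto
  then have "u \<le> C2\<^sup>2 * t" "v \<le> C2\<^sup>2 * t" using C2 by (auto simp: field_simps)
  then have uR: "u \<le> R" and vR: "v + 1 \<le> R" using R by auto
  \<comment> \<open>Since \<open>\<phi> u = t = \<phi>\<^sub>n v\<close>, the right-hand side is the
    Euler error at the single time \<open>v\<close>.\<close>
  have "\<bar>u - v\<bar> / C2\<^sup>2 \<le> \<bar>\<phi> u - \<phi> v\<bar>"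
    using phi_increment(1)[of u v] phi_increment(1)[of v u] u v
    by (cases "u \<le> v") (auto simp: abs_if)
  then have "\<bar>u - v\<bar> \<le> C2\<^sup>2 * \<bar>\<phi> v - \<phi>\<^sub>n v\<bar>"
    using C2 u v by (simp add: field_simps abs_minus_commute)
  also have "\<dots> \<le> Q * (1 + H) * real n powr (- (\<alpha> * \<beta>))"
    using v vR by (intro euler_path_error) auto
  finally have uv: "\<bar>u - v\<bar> \<le> Q * (1 + H) * real n powr (- (\<alpha> * \<beta>))" .
  have R0: "0 \<le> R" using vR v by linarith
  have Q0: "0 \<le> Q" using R0 D_nonneg nonneg C1 by (simp add: Q_def)
  have "\<bar>x v - x u\<bar> \<le> H * \<bar>u - v\<bar> powr \<alpha>"
    using x_holder[of v u] u v uR vR by (simp add: abs_minus_commute)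
  also have "\<dots> \<le> H * (Q * (1 + H) * real n powr (- (\<alpha> * \<beta>))) powr \<alpha>"
    using uv nonneg \<alpha> by (intro mult_left_mono powr_mono2) auto
  also have "(Q * (1 + H) * real n powr (- (\<alpha> * \<beta>))) powr \<alpha> = Q powr \<alpha> * (1 + H) powr \<alpha> * ?N"
    using Q0 nonneg by (simp add: powr_mult powr_powr power2_eq_square mult_ac)
  \<comment> \<open>The exponent \<alpha> on \<open>Q\<close> and on \<open>1 + H\<close> is raised
    to 1; only the power of \<open>n\<close> keeps it, which is where the second factor \<alpha> in
    the rate arises.\<close>
  also have "H * (Q powr \<alpha> * (1 + H) powr \<alpha> * ?N) \<le> (1 + H) * ((1 + Q) * (1 + H) powr 1 * ?N)"
    using Q0 nonneg \<alpha> n by (intro mult_mono powr_le_one_plus powr_mono) auto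
  finally have A: "\<bar>x v - x u\<bar> \<le> (1 + Q) * (1 + H)\<^sup>2 * ?N"
    using nonneg by (simp add: power2_eq_square mult_ac)
  \<comment> \<open>Hence the interpolation error, of order \<open>n powr -\<alpha>\<close>, is no
    worse than the time change error.\<close>
  have "\<alpha>\<^sup>2 * \<beta> \<le> \<alpha>"
    using \<alpha> \<beta> mult_mono[of "\<alpha> * \<beta>" 1 \<alpha> \<alpha>] by (simp add: power2_eq_square mult_ac mult_le_one)
  then have N: "(1 / n) powr \<alpha> \<le> ?N"
    using n powr_mono[of "-\<alpha>" "- (\<alpha>\<^sup>2 * \<beta>)" "real n"]
    by (simp add: powr_divide powr_minus_divide)
  have "\<bar>interp x v - x v\<bar> \<le> H * (1 / n) powr \<alpha>"
    by (rule interpolation_error[OF interp v(1) vR])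
  also have "\<dots> \<le> (1 + H)\<^sup>2 * ?N"
    using N nonneg by (intro mult_mono) (auto simp: power2_eq_square algebra_simps)
  finally have "\<bar>interp x v - x u\<bar> \<le> (1 + H)\<^sup>2 * ?N + (1 + Q) * (1 + H)\<^sup>2 * ?N"
    using A by linarith
  then show ?thesis unfolding u_def v_def by (simp add: algebra_simps)
qed

end

section \<open>From the pathwise bound to the moment bound\<close>

theorem theorem2:
  fixes M :: "'a measure"
    and F :: "real \<Rightarrow> 'a measure"
    and b \<xi> \<phi> :: "real \<Rightarrow> 'a \<Rightarrow> real"
    and X0 :: "'a \<Rightarrow> real"
    and \<sigma> :: "real \<Rightarrow> real \<Rightarrow> real"
    and \<beta> C1 C2 T p \<alpha> :: real
  assumes "filtered_prob_space M F"
    and "brownian_motion M F b"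
    and "X0 \<in> borel_measurable (F 0)"
    and "\<xi> = (\<lambda>t \<omega>. X0 \<omega> + b t \<omega>)"
    and "0 < \<beta>" and "\<beta> \<le> 1"
    and "0 < C1" and "0 < C2"
    and "\<And>t x. 0 \<le> t \<Longrightarrow> C1 \<le> \<sigma> t x \<and> \<sigma> t x \<le> C2"
    and "\<exists>C\<beta>>0. \<forall>S>0. \<exists>L>0. \<forall>s\<in>{0..S}. \<forall>t\<in>{0..S}. \<forall>x y.
           \<bar>\<sigma> s x - \<sigma> t y\<bar> \<le> L * \<bar>s - t\<bar> + C\<beta> * \<bar>x - y\<bar> powr \<beta>"
    and "adapted_process F \<phi>"
    and "AE \<omega> in M. time_change_path (\<lambda>t. \<phi> t \<omega>)"
    and "AE \<omega> in M. solves_time_change \<sigma> (\<lambda>t. \<xi> t \<omega>) (\<lambda>t. \<phi> t \<omega>)"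
    and "0 < T" and "1 \<le> p" and "0 \<le> \<alpha>" and "\<alpha> < 1 / 2"
  shows "\<exists>K>0. \<forall>n\<ge>1. \<forall>interp \<in> {linear_interpolation n, unscaled_interpolation n}.
    ennreal_powr
      (\<integral>\<^sup>+\<omega>. (SUP t\<in>{0..T}. ennreal
          (\<bar>interp (\<lambda>s. \<xi> s \<omega>) (path_inverse (euler_path \<sigma> (\<lambda>s. \<xi> s \<omega>) n) t)
             - \<xi> (path_inverse (\<lambda>s. \<phi> s \<omega>) t) \<omega>\<bar> powr p)) \<partial>M)
      (1 / p)
    \<le> ennreal (K * real n powr (- (\<alpha>\<^sup>2 * \<beta>)))"
proof -
  interpret prob_space M using assms(1) by (simp add: filtered_prob_space_def)
  \<comment> \<open>An exponent strictly between \<alpha> and 1/2, hence positive even for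
    \<open>\<alpha> = 0\<close>. The rate obtained for \<open>a\<close> implies the one for
    \<alpha>.\<close>
  define a where "a = (\<alpha> + 1 / 2) / 2"
  have a: "0 < a" "a < 1 / 2" "\<alpha> \<le> a" "a \<le> 1" using assms(16,17) by (auto simp: a_def)
  \<comment> \<open>On [0, T] both inverses are at most \<open>C2\<^sup>2 * T\<close>; the extra 1
    leaves space for one grid cell.\<close>
  define R where "R = C2\<^sup>2 * T + 1"
  have R: "0 < R" using assms(14) by (simp add: R_def add_nonneg_pos)
  obtain C where C: "0 < C" and hold: "\<forall>S>0. \<exists>L>0. \<forall>s\<in>{0..S}. \<forall>t\<in>{0..S}. \<forall>x y.
      \<bar>\<sigma> s x - \<sigma> t y\<bar> \<le> L * \<bar>s - t\<bar> + C * \<bar>x - y\<bar> powr \<beta>"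
    using assms(10) by blast
  have "0 < R / C1\<^sup>2" using R assms(7) by simp
  with hold obtain L where L: "0 < L" and \<sigma>_diff: "\<forall>s\<in>{0..R / C1\<^sup>2}. \<forall>t\<in>{0..R / C1\<^sup>2}. \<forall>x y.
      \<bar>\<sigma> s x - \<sigma> t y\<bar> \<le> L * \<bar>s - t\<bar> + C * \<bar>x - y\<bar> powr \<beta>"
    by blast
  obtain H where H_measurable [measurable]: "H \<in> borel_measurable M" and H0: "\<And>\<omega>. 0 \<le> H \<omega>"
    and H_moment: "(\<integral>\<^sup>+\<omega>. ennreal ((1 + H \<omega>) powr (2 * p)) \<partial>M) < \<top>"
    and H: "AE \<omega> in M. \<forall>s\<in>{0..R}. \<forall>t\<in>{0..R}. \<bar>b s \<omega> - b t \<omega>\<bar> \<le> H \<omega> * \<bar>s - t\<bar> powr a"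
    \<comment> \<open>The order \<open>2 * p\<close> comes from the square of \<open>1 + H\<close>
      in the pathwise bound.\<close>
    using brownian_holder_constant[OF assms(1,2) a(1,2) R, where p = "2 * p"] by blast
  define J where "J = enn2real (\<integral>\<^sup>+\<omega>. ennreal ((1 + H \<omega>) powr (2 * p)) \<partial>M)"
  define c where "c = 2 + euler_time_change.Q C1 C2 L C R"
  have p: "0 < p" using assms(15) by simp
  show ?thesis
  \<comment> \<open>The absolute value and the added 1 make positivity immediate, also if the moment
    factor vanishes.\<close>
  proof (intro exI[of _ "\<bar>c\<bar> * J powr (1 / p) + 1"] conjI allI impI ballI)
    show "0 < \<bar>c\<bar> * J powr (1 / p) + 1" by (simp add: add_nonneg_pos)
    fix n :: nat and interp :: "(real \<Rightarrow> real) \<Rightarrow> real \<Rightarrow> real"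
    assume n: "1 \<le> n" and interp: "interp \<in> {linear_interpolation n, unscaled_interpolation n}"
    define N where "N = real n powr (- (a\<^sup>2 * \<beta>))"
    define Err where "Err \<omega> = (SUP t\<in>{0..T}. ennreal
      (\<bar>interp (\<lambda>s. \<xi> s \<omega>) (path_inverse (euler_path \<sigma> (\<lambda>s. \<xi> s \<omega>) n) t)
         - \<xi> (path_inverse (\<lambda>s. \<phi> s \<omega>) t) \<omega>\<bar> powr p))" for \<omega>
    have "AE \<omega> in M. Err \<omega> \<le> ennreal ((\<bar>c\<bar> * N) powr p) * ennreal ((1 + H \<omega>) powr (2 * p))"
      using H assms(12,13)
    proof eventually_elim
      case (elim \<omega>)
      \<comment> \<open>\<open>X0\<close> cancels in the increments of \<xi>, so the Hoelder
        constant of \<open>b\<close> serves for \<xi>.\<close>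
      interpret euler_time_change \<sigma> "\<lambda>t. \<xi> t \<omega>" "\<lambda>t. \<phi> t \<omega>" C1 C2 L C \<beta> a "H \<omega>" R n
        using elim assms(5-7,9) a L C H0 \<sigma>_diff n by unfold_locales (auto simp: assms(4))
      show ?case unfolding Err_def
      proof (rule SUP_least)
        fix t assume t: "t \<in> {0..T}"
        then have "C2\<^sup>2 * t + 1 \<le> R" by (simp add: R_def mult_left_mono)
        then have "\<bar>interp (\<lambda>s. \<xi> s \<omega>) (path_inverse (euler_path \<sigma> (\<lambda>s. \<xi> s \<omega>) n) t)
            - \<xi> (path_inverse (\<lambda>s. \<phi> s \<omega>) t) \<omega>\<bar> \<le> c * (1 + H \<omega>)\<^sup>2 * N"
          using t unfolding c_def N_def by (intro pathwise_error[OF interp]) auto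
        also have "\<dots> \<le> \<bar>c\<bar> * (1 + H \<omega>)\<^sup>2 * N"
          by (intro mult_right_mono) (auto simp: N_def)
        finally have "\<bar>interp (\<lambda>s. \<xi> s \<omega>) (path_inverse (euler_path \<sigma> (\<lambda>s. \<xi> s \<omega>) n) t)
            - \<xi> (path_inverse (\<lambda>s. \<phi> s \<omega>) t) \<omega>\<bar> powr p \<le> (\<bar>c\<bar> * (1 + H \<omega>)\<^sup>2 * N) powr p"
          using p by (intro powr_mono2) auto
        also have "\<dots> = (\<bar>c\<bar> * N) powr p * (1 + H \<omega>) powr (2 * p)"
        proof -
          have "(1 + H \<omega>)\<^sup>2 = (1 + H \<omega>) powr 2" using H0[of \<omega>] by simp
          then have "((1 + H \<omega>)\<^sup>2) powr p = (1 + H \<omega>) powr (2 * p)" by (simp only: powr_powr)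
          then show ?thesis using H0[of \<omega>] by (simp add: powr_mult N_def mult_ac)
        qed
        finally show "ennreal (\<bar>interp (\<lambda>s. \<xi> s \<omega>) (path_inverse (euler_path \<sigma> (\<lambda>s. \<xi> s \<omega>) n) t)
            - \<xi> (path_inverse (\<lambda>s. \<phi> s \<omega>) t) \<omega>\<bar> powr p)
          \<le> ennreal ((\<bar>c\<bar> * N) powr p) * ennreal ((1 + H \<omega>) powr (2 * p))"
          by (simp add: ennreal_leI flip: ennreal_mult)
      qed
    qed
    \<comment> \<open>Monotonicity under an almost sure inequality asks for no measurability of the
      supremum \<open>Err\<close>.\<close>
    then have "(\<integral>\<^sup>+\<omega>. Err \<omega> \<partial>M)
        \<le> (\<integral>\<^sup>+\<omega>. ennreal ((\<bar>c\<bar> * N) powr p) * ennreal ((1 + H \<omega>) powr (2 * p)) \<partial>M)"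
      by (rule nn_integral_mono_AE)
    also have "\<dots> = ennreal ((\<bar>c\<bar> * N) powr p) * (\<integral>\<^sup>+\<omega>. ennreal ((1 + H \<omega>) powr (2 * p)) \<partial>M)"
      by (rule nn_integral_cmult) measurable
    also have "\<dots> = ennreal ((\<bar>c\<bar> * N) powr p * J)"
      using H_moment by (simp add: J_def ennreal_mult less_top)
    finally have le: "(\<integral>\<^sup>+\<omega>. Err \<omega> \<partial>M) \<le> ennreal ((\<bar>c\<bar> * N) powr p * J)" .
    have J: "0 \<le> J" by (simp add: J_def)
    have "enn2real (\<integral>\<^sup>+\<omega>. Err \<omega> \<partial>M) \<le> (\<bar>c\<bar> * N) powr p * J"
      using enn2real_mono[OF le] J by simp
    then have "enn2real (\<integral>\<^sup>+\<omega>. Err \<omega> \<partial>M) powr (1 / p) \<le> ((\<bar>c\<bar> * N) powr p * J) powr (1 / p)"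
      using p by (intro powr_mono2) auto
    also have "\<dots> = \<bar>c\<bar> * J powr (1 / p) * N"
      using p J by (simp add: powr_mult powr_powr N_def)
    also have "\<dots> \<le> (\<bar>c\<bar> * J powr (1 / p) + 1) * real n powr (- (\<alpha>\<^sup>2 * \<beta>))"
    proof (intro mult_mono)
      have "\<alpha>\<^sup>2 * \<beta> \<le> a\<^sup>2 * \<beta>"
        using a assms(5,16) by (intro mult_right_mono power_mono) auto
      then show "N \<le> real n powr (- (\<alpha>\<^sup>2 * \<beta>))"
        unfolding N_def using n by (intro powr_mono) auto
    qed (auto simp: N_def)
    \<comment> \<open>The finite bound \<open>le\<close> rules out the infinite case in
      \<open>ennreal_powr\<close>.\<close>
    finally have "ennreal_powr (\<integral>\<^sup>+\<omega>. Err \<omega> \<partial>M) (1 / p)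
        \<le> ennreal ((\<bar>c\<bar> * J powr (1 / p) + 1) * real n powr (- (\<alpha>\<^sup>2 * \<beta>)))"
      using le by (auto simp: ennreal_powr_def ennreal_leI top_unique)
    then show "ennreal_powr
      (\<integral>\<^sup>+\<omega>. (SUP t\<in>{0..T}. ennreal
          (\<bar>interp (\<lambda>s. \<xi> s \<omega>) (path_inverse (euler_path \<sigma> (\<lambda>s. \<xi> s \<omega>) n) t)
             - \<xi> (path_inverse (\<lambda>s. \<phi> s \<omega>) t) \<omega>\<bar> powr p)) \<partial>M)
      (1 / p)
    \<le> ennreal ((\<bar>c\<bar> * J powr (1 / p) + 1) * real n powr (- (\<alpha>\<^sup>2 * \<beta>)))"
      unfolding Err_def .
  qed
qed

end
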